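(* For a regular Hausdorff space $X$ the following are equivalent: (1) $X$ has a $\sigma$-locally countable base; (2) $\mathcal{K}(X)$ has a $\sigma$-locally countable weak base; (3) $\mathcal{K}(X)$ has a $\sigma$-locally countable base.
   Context: $\mathcal{K}(X)$ is the set of nonempty compact subsets of $X$ with the Vietoris topology (base: $\langle U_1,\dots,U_k\rangle=\{K: K\subset\bigcup_i U_i,\ K\cap U_j\neq\emptyset\ \forall j\}$, $U_i$ open in $X$). A weak base for $Y$ is a cover $\mathcal{P}=\bigcup_{y\in Y}\mathcal{P}_y$ such that: for $U,V\in\mathcal{P}_y$ there is $W\in\mathcal{P}_y$ with $W\subset U\cap V$; each member of $\mathcal{P}_y$ contains $y$, and for each open $U\ni y$ some $P\in\mathcal{P}_y$ has $P\subset U$; and $G\subset Y$ is open whenever for each $y\in G$ some $P\in\mathcal{P}_y$ has $P\subset G$. A family is locally countable if each point has a neighborhood meeting only countably many members; $\sigma$-locally countable means a countable union of locally countable families. *)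

theory Defs
  imports "HOL-Analysis.Analysis"
begin

definition vietoris_box :: "'a topology \<Rightarrow> 'a set list \<Rightarrow> 'a set set" where
  "vietoris_box X Us = {K. compactin X K \<and> K \<noteq> {} \<and> K \<subseteq> \<Union>(set Us) \<and> (\<forall>U\<in>set Us. K \<inter> U \<noteq> {})}"

definition vietoris_base :: "'a topology \<Rightarrow> 'a set set set" where
  "vietoris_base X = {vietoris_box X Us | Us. Us \<noteq> [] \<and> (\<forall>U\<in>set Us. openin X U)}"

definition hyperspace_K :: "'a topology \<Rightarrow> 'a set topology" where
  "hyperspace_K X = topology_generated_by (vietoris_base X)"

definition is_base :: "'a topology \<Rightarrow> 'a set set \<Rightarrow> bool" where
  "is_base X B \<longleftrightarrow> (\<forall>V\<in>B. openin X V) \<and>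
     (\<forall>U x. openin X U \<and> x \<in> U \<longrightarrow> (\<exists>V\<in>B. x \<in> V \<and> V \<subseteq> U))"

(* P y is the family P_y; the weak base itself is the union of the P y over y in the space *)
definition is_weak_base :: "'a topology \<Rightarrow> ('a \<Rightarrow> 'a set set) \<Rightarrow> bool" where
  "is_weak_base Y P \<longleftrightarrow>
     (\<forall>y\<in>topspace Y. \<forall>Q\<in>P y. Q \<subseteq> topspace Y \<and> y \<in> Q) \<and>
     (\<forall>y\<in>topspace Y. \<forall>U\<in>P y. \<forall>V\<in>P y. \<exists>W\<in>P y. W \<subseteq> U \<inter> V) \<and>
     (\<forall>y\<in>topspace Y. \<forall>U. openin Y U \<and> y \<in> U \<longrightarrow> (\<exists>Q\<in>P y. Q \<subseteq> U)) \<and>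
     (\<forall>G. G \<subseteq> topspace Y \<and> (\<forall>y\<in>G. \<exists>Q\<in>P y. Q \<subseteq> G) \<longrightarrow> openin Y G)"

definition locally_countable_family :: "'a topology \<Rightarrow> 'a set set \<Rightarrow> bool" where
  "locally_countable_family X F \<longleftrightarrow>
     (\<forall>x\<in>topspace X. \<exists>V. openin X V \<and> x \<in> V \<and> countable {A\<in>F. A \<inter> V \<noteq> {}})"

definition sigma_locally_countable :: "'a topology \<Rightarrow> 'a set set \<Rightarrow> bool" where
  "sigma_locally_countable X F \<longleftrightarrow>
     (\<exists>Fs :: nat \<Rightarrow> 'a set set. F = (\<Union>n. Fs n) \<and> (\<forall>n. locally_countable_family X (Fs n)))"

end

theory Submission
  imports Defs
begin

text \<open>
  The substantial implication is that a \<open>\<sigma>\<close>-locally countable weak base of the hyperspace yields a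
  \<open>\<sigma>\<close>-locally countable base of \<open>X\<close>. Such a weak base is countable at each point and restricts along
  \<open>x \<mapsto> {x}\<close> to a weak base of \<open>X\<close>; it is enough that each restricted member \<open>Q\<close> at \<open>x\<close> is a
  neighbourhood of \<open>x\<close>, since the interiors then form a base. If this fails, there are points
  \<open>x\<^sub>k \<longrightarrow> z\<close> and, for each \<open>k\<close>, points \<open>w\<^sub>k\<^sub>m \<longrightarrow> x\<^sub>k\<close> outside \<open>Q\<close>, whereas no sequence outside \<open>Q\<close>
  converges to \<open>z\<close>. With \<open>K = {z} \<union> {x\<^sub>k}\<close>, the compact sets \<open>K \<union> {w\<^sub>k\<^sub>m}\<close> form a sequential fan at
  \<open>K\<close>. Members of a weak base are sequential neighbourhoods, so countability of the weak base at \<open>K\<close>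
  gives a diagonal sequence \<open>v\<^sub>k = w\<^sub>k\<^sub>m\<close> eventually inside every open set containing \<open>K\<close>. Choosing
  \<open>v\<^sub>k\<close> also to avoid fixed neighbourhoods of the earlier \<open>x\<^sub>n\<close> forces \<open>v\<^sub>k \<longrightarrow> z\<close>, a contradiction.
\<close>

section \<open>Weak bases\<close>

lemma is_weak_baseD:
  assumes "is_weak_base Y P" "y \<in> topspace Y"
  shows "Q \<in> P y \<Longrightarrow> Q \<subseteq> topspace Y" "Q \<in> P y \<Longrightarrow> y \<in> Q"
    and "U \<in> P y \<Longrightarrow> V \<in> P y \<Longrightarrow> \<exists>W\<in>P y. W \<subseteq> U \<inter> V"
    and "openin Y G \<Longrightarrow> y \<in> G \<Longrightarrow> \<exists>Q\<in>P y. Q \<subseteq> G"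
  using assms unfolding is_weak_base_def by metis+

lemma openin_weak_base:
  assumes "is_weak_base Y P" "G \<subseteq> topspace Y" "\<And>y. y \<in> G \<Longrightarrow> \<exists>Q\<in>P y. Q \<subseteq> G"
  shows "openin Y G"
  using assms unfolding is_weak_base_def by simp

lemma is_baseD:
  assumes "is_base X B"
  shows "V \<in> B \<Longrightarrow> openin X V"
    and "openin X U \<Longrightarrow> x \<in> U \<Longrightarrow> \<exists>V\<in>B. x \<in> V \<and> V \<subseteq> U"
  using assms by (simp_all add: is_base_def)

lemma is_base_imp_weak_base:
  assumes B: "is_base Y B"
  shows "is_weak_base Y (\<lambda>y. {V \<in> B. y \<in> V})"
  unfolding is_weak_base_def
proof (intro conjI ballI allI impI)
  fix y U V assume "U \<in> {V \<in> B. y \<in> V}" "V \<in> {V \<in> B. y \<in> V}"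
  then have "openin Y (U \<inter> V)" "y \<in> U \<inter> V"
    using is_baseD(1) [OF B] by auto
  from is_baseD(2) [OF B this] show "\<exists>W\<in>{V \<in> B. y \<in> V}. W \<subseteq> U \<inter> V"
    by blast
next
  fix G assume G: "G \<subseteq> topspace Y \<and> (\<forall>y\<in>G. \<exists>Q\<in>{V \<in> B. y \<in> V}. Q \<subseteq> G)"
  have "\<exists>T. openin Y T \<and> y \<in> T \<and> T \<subseteq> G" if "y \<in> G" for y
    using G that is_baseD(1) [OF B] by blast
  then show "openin Y G"
    by (subst openin_subopen) blast
next
  fix y U assume "openin Y U \<and> y \<in> U"
  then show "\<exists>Q\<in>{V \<in> B. y \<in> V}. Q \<subseteq> U"
    using is_baseD(2) [OF B, of U y] by blast
qed (use is_baseD(1) [OF B] in \<open>auto dest: openin_subset\<close>)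

text \<open>Let \<open>C\<close> collect the terms outside \<open>Q\<close>. With the limit adjoined
  it is compact, hence closed, and the complement of \<open>C\<close> passes the weak-base test for
  openness: \<open>Q\<close> serves at \<open>y\<close>, an open set serves elsewhere. So the
  sequence ends up in that complement.\<close>

lemma weak_base_eventually:
  assumes "Hausdorff_space Y" and P: "is_weak_base Y P" and y: "y \<in> topspace Y"
    and Q: "Q \<in> P y" and lim: "limitin Y s y sequentially"
  shows "\<forall>\<^sub>F n in sequentially. s n \<in> Q"
proof -
  define C where "C = {s n | n. s n \<in> topspace Y \<and> s n \<notin> Q}"
  have "compactin Y (insert y C)"
    by (rule compactin_sequence_with_limit [OF lim]) (auto simp: C_def)
  then have closed: "closedin Y (insert y C)"
    using assms(1) compactin_imp_closedin by blast
  have "openin Y (topspace Y - C)"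
  proof (rule openin_weak_base [OF P])
    fix w assume w: "w \<in> topspace Y - C"
    show "\<exists>Q\<in>P w. Q \<subseteq> topspace Y - C"
    proof (cases "w = y")
      case True
      have "Q \<subseteq> topspace Y - C"
        using is_weak_baseD(1) [OF P y Q] by (auto simp: C_def)
      with True Q show ?thesis by blast
    next
      case False
      then have "w \<in> topspace Y - insert y C" using w by blast
      then have "\<exists>Q\<in>P w. Q \<subseteq> topspace Y - insert y C"
        using is_weak_baseD(4) [OF P] closed w by (metis DiffE openin_diff openin_topspace)
      then show ?thesis by blast
    qed
  qed auto
  moreover have "y \<in> topspace Y - C"
    using is_weak_baseD(2) [OF P y Q] y by (auto simp: C_def)
  ultimately have "\<forall>\<^sub>F n in sequentially. s n \<in> topspace Y - C"
    using lim unfolding limitin_def by blast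
  then show ?thesis
    by (rule eventually_mono) (auto simp: C_def)
qed

text \<open>Enumerate \<open>P y\<close> and shrink step by step: \<open>R (Suc k)\<close> lies in
  both \<open>R k\<close> and the \<open>k\<close>-th member \<open>e k\<close>. The decreasing
  sequence thus enters every member.\<close>

lemma weak_base_sequence:
  assumes P: "is_weak_base Y P" and y: "y \<in> topspace Y" and c: "countable (P y)"
  obtains R :: "nat \<Rightarrow> 'a set"
  where "\<And>k. R k \<in> P y" "\<And>Q. Q \<in> P y \<Longrightarrow> \<forall>\<^sub>F k in sequentially. R k \<subseteq> Q"
proof -
  have ne: "P y \<noteq> {}"
    using is_weak_baseD(4) [OF P y, of "topspace Y"] y by auto
  define e where "e = from_nat_into (P y)"
  have e: "e k \<in> P y" for k
    using ne by (simp add: e_def from_nat_into)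
  have "\<exists>R. \<forall>k. R k \<in> P y \<and> R (Suc k) \<subseteq> R k \<inter> e k"
  proof (rule dependent_nat_choice)
    show "\<exists>Q. Q \<in> P y" using ne by blast
  next
    fix Q k assume "Q \<in> P y"
    then show "\<exists>W. W \<in> P y \<and> W \<subseteq> Q \<inter> e k"
      using is_weak_baseD(3) [OF P y _ e] by blast
  qed
  then obtain R where R: "\<And>k. R k \<in> P y" "\<And>k. R (Suc k) \<subseteq> R k \<inter> e k"
    by blast
  have anti: "R n \<subseteq> R m" if "m \<le> n" for m n
    using lift_Suc_antimono_le [of R, OF _ that] R(2) by blast
  show thesis
  proof (rule that [OF R(1)])
    fix Q assume "Q \<in> P y"
    then obtain k where "e k = Q"
      using from_nat_into_surj [OF c] unfolding e_def by blast
    then have "R n \<subseteq> Q" if "n \<ge> Suc k" for n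
      using anti [OF that] R(2) [of k] by blast
    then show "\<forall>\<^sub>F k in sequentially. R k \<subseteq> Q"
      using eventually_sequentially by blast
  qed
qed

text \<open>Pick a point of each \<open>R k\<close> outside \<open>A\<close>; an open set around
  \<open>y\<close> contains a member of \<open>P y\<close>, hence almost all \<open>R k\<close>.
  This turns failure of the weak-base test into a convergent sequence.\<close>

lemma weak_base_limit_outside:
  assumes P: "is_weak_base Y P" and y: "y \<in> topspace Y" and c: "countable (P y)"
    and A: "\<And>Q. Q \<in> P y \<Longrightarrow> \<not> Q \<subseteq> A"
  obtains s where "limitin Y s y sequentially" "\<And>n::nat. s n \<in> topspace Y - A"
proof -
  obtain R :: "nat \<Rightarrow> 'a set" where R: "\<And>k. R k \<in> P y"
    "\<And>Q. Q \<in> P y \<Longrightarrow> \<forall>\<^sub>F k in sequentially. R k \<subseteq> Q"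
    using weak_base_sequence [OF P y c] by blast
  have "\<forall>k. \<exists>x. x \<in> R k - A" using A R(1) by blast
  then obtain s where s: "\<And>k. s k \<in> R k - A" by metis
  show thesis
  proof
    show "s n \<in> topspace Y - A" for n
      using s is_weak_baseD(1) [OF P y R(1)] by blast
    show "limitin Y s y sequentially"
      unfolding limitin_def
    proof (intro conjI allI impI y)
      fix U assume "openin Y U \<and> y \<in> U"
      then obtain Q where "Q \<in> P y" "Q \<subseteq> U" using is_weak_baseD(4) [OF P y] by blast
      with R(2) [of Q] show "\<forall>\<^sub>F k in sequentially. s k \<in> U"
        using s by (auto elim!: eventually_mono)
    qed
  qed
qed

section \<open>Local countability\<close>

lemma locally_countable_family_subset:
  assumes "locally_countable_family X F" "G \<subseteq> F"
  shows "locally_countable_family X G"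
  unfolding locally_countable_family_def
proof
  fix x assume "x \<in> topspace X"
  then obtain V where "openin X V" "x \<in> V" "countable {A \<in> F. A \<inter> V \<noteq> {}}"
    using assms(1) unfolding locally_countable_family_def by blast
  moreover have "{A \<in> G. A \<inter> V \<noteq> {}} \<subseteq> {A \<in> F. A \<inter> V \<noteq> {}}"
    using assms(2) by blast
  ultimately show "\<exists>V. openin X V \<and> x \<in> V \<and> countable {A \<in> G. A \<inter> V \<noteq> {}}"
    using countable_subset by blast
qed

lemma sigma_locally_countable_subset:
  assumes "sigma_locally_countable X F" "G \<subseteq> F"
  shows "sigma_locally_countable X G"
proof -
  obtain Fs :: "nat \<Rightarrow> _" where Fs: "F = (\<Union>n. Fs n)" "\<And>n. locally_countable_family X (Fs n)"
    using assms(1) unfolding sigma_locally_countable_def by blast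
  have "G = (\<Union>n. Fs n \<inter> G)" using Fs(1) assms(2) by blast
  moreover have "locally_countable_family X (Fs n \<inter> G)" for n
    by (rule locally_countable_family_subset [OF Fs(2) Int_lower1])
  ultimately show ?thesis
    unfolding sigma_locally_countable_def by (intro exI [of _ "\<lambda>n. Fs n \<inter> G"]) simp
qed

text \<open>At each level the members through \<open>x\<close> all meet a neighbourhood that meets
  only countably many. This supplies the pointwise countability from which sequences are
  built.\<close>

lemma sigma_locally_countable_point:
  assumes "sigma_locally_countable X F" "x \<in> topspace X"
  shows "countable {A \<in> F. x \<in> A}"
proof -
  obtain Fs :: "nat \<Rightarrow> _" where Fs: "F = (\<Union>n. Fs n)" "\<And>n. locally_countable_family X (Fs n)"
    using assms(1) unfolding sigma_locally_countable_def by blast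
  have "countable {A \<in> Fs n. x \<in> A}" for n
  proof -
    obtain V where "x \<in> V" "countable {A \<in> Fs n. A \<inter> V \<noteq> {}}"
      using Fs(2) assms(2) unfolding locally_countable_family_def by blast
    then show ?thesis by (rule_tac countable_subset) auto
  qed
  moreover have "{A \<in> F. x \<in> A} = (\<Union>n. {A \<in> Fs n. x \<in> A})" using Fs(1) by blast
  ultimately show ?thesis by simp
qed

text \<open>If \<open>h A\<close> meets the preimage of \<open>V\<close>, then \<open>A\<close>
  meets \<open>V\<close>. Only an inclusion is asked of \<open>h\<close>, so that it may be the
  interior of a preimage.\<close>

lemma sigma_locally_countable_pullback:
  assumes f: "continuous_map X Y f" and "sigma_locally_countable Y F"
    and h: "\<And>A. h A \<subseteq> f -` A"
  shows "sigma_locally_countable X (h ` F)"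
proof -
  obtain Fs :: "nat \<Rightarrow> _" where Fs: "F = (\<Union>n. Fs n)" "\<And>n. locally_countable_family Y (Fs n)"
    using assms(2) unfolding sigma_locally_countable_def by blast
  have "locally_countable_family X (h ` Fs n)" for n
    unfolding locally_countable_family_def
  proof
    fix x assume x: "x \<in> topspace X"
    then have "f x \<in> topspace Y" using f by (auto simp: continuous_map_def)
    then obtain V where V: "openin Y V" "f x \<in> V" "countable {A \<in> Fs n. A \<inter> V \<noteq> {}}"
      using Fs(2) unfolding locally_countable_family_def by blast
    let ?W = "{x \<in> topspace X. f x \<in> V}"
    have "{A \<in> h ` Fs n. A \<inter> ?W \<noteq> {}} \<subseteq> h ` {A \<in> Fs n. A \<inter> V \<noteq> {}}"
    proof
      fix C assume "C \<in> {A \<in> h ` Fs n. A \<inter> ?W \<noteq> {}}"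
      then obtain A x where "A \<in> Fs n" "C = h A" "x \<in> h A" "f x \<in> V" by blast
      moreover from this have "f x \<in> A" using h by blast
      ultimately show "C \<in> h ` {A \<in> Fs n. A \<inter> V \<noteq> {}}" by blast
    qed
    then have "countable {A \<in> h ` Fs n. A \<inter> ?W \<noteq> {}}"
      by (rule countable_subset) (rule countable_image [OF V(3)])
    moreover have "openin X ?W" using f V(1) by (simp add: openin_continuous_map_preimage)
    ultimately show "\<exists>V. openin X V \<and> x \<in> V \<and> countable {A \<in> h ` Fs n. A \<inter> V \<noteq> {}}"
      using x V(2) by blast
  qed
  moreover have "h ` F = (\<Union>n. h ` Fs n)" using Fs(1) by blast
  ultimately show ?thesis unfolding sigma_locally_countable_def by blast
qed

section \<open>The Vietoris topology\<close>

lemma topspace_hyperspace_K: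
  "topspace (hyperspace_K X) = {K. compactin X K \<and> K \<noteq> {}}"
proof
  show "topspace (hyperspace_K X) \<subseteq> {K. compactin X K \<and> K \<noteq> {}}"
    by (auto simp: hyperspace_K_def vietoris_base_def vietoris_box_def)
  have "K \<in> vietoris_box X [topspace X]" if "compactin X K" "K \<noteq> {}" for K
    using that compactin_subset_topspace [OF that(1)] by (auto simp: vietoris_box_def)
  moreover have "vietoris_box X [topspace X] \<in> vietoris_base X"
    by (auto simp: vietoris_base_def intro!: exI [of _ "[topspace X]"])
  ultimately show "{K. compactin X K \<and> K \<noteq> {}} \<subseteq> topspace (hyperspace_K X)"
    by (auto simp: hyperspace_K_def)
qed

lemma openin_vietoris_box:
  assumes "Us \<noteq> []" "\<And>U. U \<in> set Us \<Longrightarrow> openin X U"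
  shows "openin (hyperspace_K X) (vietoris_box X Us)"
  unfolding hyperspace_K_def
  by (rule topology_generated_by_Basis) (use assms in \<open>auto simp: vietoris_base_def\<close>)

text \<open>Around each point of \<open>K\<close> take a basic set inside all listed sets containing
  that point, then use compactness. Two lists are refined at once to treat intersections of boxes;
  equal lists shrink a single box to sets of \<open>B\<close>.\<close>

lemma vietoris_box_refine:
  assumes B: "is_base X B"
    and Us: "\<And>U. U \<in> set Us \<Longrightarrow> openin X U" "K \<in> vietoris_box X Us"
    and Vs: "\<And>U. U \<in> set Vs \<Longrightarrow> openin X U" "K \<in> vietoris_box X Vs"
  obtains Ws where "Ws \<noteq> []" "set Ws \<subseteq> B" "K \<in> vietoris_box X Ws"
    "vietoris_box X Ws \<subseteq> vietoris_box X Us \<inter> vietoris_box X Vs"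
proof -
  let ?S = "set Us \<union> set Vs"
  have K: "compactin X K" "K \<noteq> {}" using Us(2) by (auto simp: vietoris_box_def)
  have "\<exists>V\<in>B. x \<in> V \<and> (\<forall>U\<in>?S. x \<in> U \<longrightarrow> V \<subseteq> U)" if "x \<in> K" for x
  proof -
    have x: "x \<in> topspace X" using K(1) compactin_subset_topspace that by blast
    have "openin X (topspace X \<inter> \<Inter>{U \<in> ?S. x \<in> U})"
      by (intro openin_Int_Inter) (use Us(1) Vs(1) in auto)
    then have "\<exists>V\<in>B. x \<in> V \<and> V \<subseteq> topspace X \<inter> \<Inter>{U \<in> ?S. x \<in> U}"
      by (rule is_baseD(2) [OF B]) (use x in auto)
    then show ?thesis by blast
  qed
  then obtain N where N: "\<And>x. x \<in> K \<Longrightarrow> N x \<in> B" "\<And>x. x \<in> K \<Longrightarrow> x \<in> N x"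
      "\<And>x U. x \<in> K \<Longrightarrow> U \<in> ?S \<Longrightarrow> x \<in> U \<Longrightarrow> N x \<subseteq> U"
    by metis
  have "\<forall>V\<in>N ` K. openin X V" "K \<subseteq> \<Union>(N ` K)"
    using N(1,2) is_baseD(1) [OF B] by auto
  then have "\<exists>\<F>. finite \<F> \<and> \<F> \<subseteq> N ` K \<and> K \<subseteq> \<Union>\<F>"
    using K(1) by (simp add: compactin_def)
  then obtain T where T: "finite T" "T \<subseteq> K" "K \<subseteq> \<Union>(N ` T)"
    by (metis finite_subset_image)
  \<comment> \<open>A finite subcover handles containment only. The extra sets
    \<open>N (p U)\<close>, each inside \<open>U\<close>, force members of the new box to meet every
    \<open>U\<close>.\<close>
  have "\<forall>U\<in>?S. \<exists>x. x \<in> K \<and> x \<in> U" using Us(2) Vs(2) by (auto simp: vietoris_box_def)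
  then obtain p where p: "\<And>U. U \<in> ?S \<Longrightarrow> p U \<in> K \<and> p U \<in> U" by metis
  let ?T = "T \<union> p ` ?S"
  have "finite (N ` ?T)" using T(1) by simp
  then obtain Ws where Ws: "set Ws = N ` ?T" using finite_list by blast
  have TK: "?T \<subseteq> K" using T(2) p by blast
  have sub: "vietoris_box X Ws \<subseteq> vietoris_box X Zs"
    if Z: "set Zs \<subseteq> ?S" "K \<in> vietoris_box X Zs" for Zs
  proof
    fix L assume L: "L \<in> vietoris_box X Ws"
    have "\<Union>(N ` ?T) \<subseteq> \<Union>(set Zs)"
    proof
      fix a assume "a \<in> \<Union>(N ` ?T)"
      then obtain x where x: "x \<in> K" "a \<in> N x" using TK by blast
      then obtain U where "U \<in> set Zs" "x \<in> U" using Z(2) by (auto simp: vietoris_box_def)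
      then show "a \<in> \<Union>(set Zs)" using N(3) x Z(1) by blast
    qed
    moreover have "L \<inter> U \<noteq> {}" if "U \<in> set Zs" for U
    proof -
      have U: "U \<in> ?S" using that Z(1) by blast
      then have "N (p U) \<subseteq> U" using N(3) p by blast
      moreover have "L \<inter> N (p U) \<noteq> {}" using L U Ws by (auto simp: vietoris_box_def)
      ultimately show ?thesis by blast
    qed
    moreover have "compactin X L \<and> L \<noteq> {} \<and> L \<subseteq> \<Union>(N ` ?T)"
      using L unfolding vietoris_box_def Ws by simp
    ultimately show "L \<in> vietoris_box X Zs"
      unfolding vietoris_box_def mem_Collect_eq by (meson order_trans)
  qed
  show thesis
  proof
    show "Ws \<noteq> []" using Ws T(3) K(2) by auto
    show "set Ws \<subseteq> B" using Ws N(1) TK by auto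
    show "K \<in> vietoris_box X Ws"
    proof -
      have "K \<subseteq> \<Union>(set Ws)" using T(3) unfolding Ws by blast
      moreover have "\<forall>U\<in>set Ws. K \<inter> U \<noteq> {}" using TK N(2) unfolding Ws by blast
      ultimately show ?thesis using K by (simp add: vietoris_box_def)
    qed
    show "vietoris_box X Ws \<subseteq> vietoris_box X Us \<inter> vietoris_box X Vs"
      using sub Us(2) Vs(2) by simp
  qed
qed

lemma is_base_vietoris_boxes:
  assumes B: "is_base X B"
  shows "is_base (hyperspace_K X) (vietoris_box X ` {Us. Us \<noteq> [] \<and> set Us \<subseteq> B})"
  unfolding is_base_def
proof (intro conjI ballI allI impI)
  fix V assume "V \<in> vietoris_box X ` {Us. Us \<noteq> [] \<and> set Us \<subseteq> B}"
  then show "openin (hyperspace_K X) V"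
    using is_baseD(1) [OF B] by (auto intro!: openin_vietoris_box)
next
  fix G K assume "openin (hyperspace_K X) G \<and> K \<in> G"
  then have "generate_topology_on (vietoris_base X) G" "K \<in> G"
    by (simp_all add: hyperspace_K_def openin_topology_generated_by_iff)
  then have "\<exists>Us. Us \<noteq> [] \<and> set Us \<subseteq> B \<and> K \<in> vietoris_box X Us \<and> vietoris_box X Us \<subseteq> G"
  proof (induction rule: generate_topology_on.induct)
    case (Int a b)
    then obtain Us Vs where U: "set Us \<subseteq> B" "K \<in> vietoris_box X Us" "vietoris_box X Us \<subseteq> a"
      and V: "set Vs \<subseteq> B" "K \<in> vietoris_box X Vs" "vietoris_box X Vs \<subseteq> b"
      by (metis IntE)
    obtain Ws where "Ws \<noteq> []" "set Ws \<subseteq> B" "K \<in> vietoris_box X Ws"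
      "vietoris_box X Ws \<subseteq> vietoris_box X Us \<inter> vietoris_box X Vs"
      by (rule vietoris_box_refine [OF B _ U(2) _ V(2)])
        (use is_baseD(1) [OF B] U(1) V(1) in auto)
    with U(3) V(3) show ?case by (intro exI [of _ Ws]) auto
  next
    case (UN \<K>)
    then obtain k where "k \<in> \<K>" "K \<in> k" by blast
    with UN.IH [of k] show ?case by blast
  next
    case (Basis s)
    then obtain Us where U: "s = vietoris_box X Us" "\<And>U. U \<in> set Us \<Longrightarrow> openin X U"
      by (auto simp: vietoris_base_def)
    have KU: "K \<in> vietoris_box X Us" using Basis.prems U(1) by simp
    obtain Ws where "Ws \<noteq> []" "set Ws \<subseteq> B" "K \<in> vietoris_box X Ws"
      "vietoris_box X Ws \<subseteq> vietoris_box X Us \<inter> vietoris_box X Us"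
      using vietoris_box_refine [OF B U(2) KU U(2) KU] by blast
    with U(1) show ?case by blast
  qed simp
  then show "\<exists>V\<in>vietoris_box X ` {Us. Us \<noteq> [] \<and> set Us \<subseteq> B}. K \<in> V \<and> V \<subseteq> G"
    by blast
qed

section \<open>Local countability of families of Vietoris boxes\<close>

lemma locally_countable_family_compact_nbhd:
  assumes F: "locally_countable_family X F" and K: "compactin X K"
  obtains V where "openin X V" "K \<subseteq> V" "countable {A \<in> F. A \<inter> V \<noteq> {}}"
proof -
  let ?\<U> = "{V. openin X V \<and> countable {A \<in> F. A \<inter> V \<noteq> {}}}"
  have "K \<subseteq> \<Union>?\<U>"
    using F compactin_subset_topspace [OF K] unfolding locally_countable_family_def by blast
  moreover have "\<forall>U\<in>?\<U>. openin X U" by blast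
  ultimately obtain \<F> where \<F>: "finite \<F>" "\<F> \<subseteq> ?\<U>" "K \<subseteq> \<Union>\<F>"
    using K unfolding compactin_def by meson
  show thesis
  proof
    show "openin X (\<Union>\<F>)" using \<F>(2) by blast
    have "countable (\<Union>V\<in>\<F>. {A \<in> F. A \<inter> V \<noteq> {}})"
      using \<F>(1,2) by (intro countable_UN) (auto simp: countable_finite)
    moreover have "{A \<in> F. A \<inter> \<Union>\<F> \<noteq> {}} = (\<Union>V\<in>\<F>. {A \<in> F. A \<inter> V \<noteq> {}})" by blast
    ultimately show "countable {A \<in> F. A \<inter> \<Union>\<F> \<noteq> {}}" by simp
  qed (rule \<F>(3))
qed

text \<open>Intersect the finitely many neighbourhoods. Finite unions of levels are needed because
  one box may mix sets of several levels.\<close>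

lemma locally_countable_family_UN:
  fixes n :: nat
  assumes "\<And>i. locally_countable_family X (Fs i)"
  shows "locally_countable_family X (\<Union>i\<le>n. Fs i)"
  unfolding locally_countable_family_def
proof
  fix x assume x: "x \<in> topspace X"
  then have "\<forall>i. \<exists>V. openin X V \<and> x \<in> V \<and> countable {A \<in> Fs i. A \<inter> V \<noteq> {}}"
    using assms by (simp add: locally_countable_family_def)
  from choice [OF this] obtain V where V: "\<And>i. openin X (V i)" "\<And>i. x \<in> V i"
    "\<And>i. countable {A \<in> Fs i. A \<inter> V i \<noteq> {}}" by auto
  have "countable (\<Union>i\<le>n. {A \<in> Fs i. A \<inter> V i \<noteq> {}})" using V(3) by auto
  then have "countable {A \<in> (\<Union>i\<le>n. Fs i). A \<inter> (\<Inter>i\<le>n. V i) \<noteq> {}}"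
    by (rule countable_subset [rotated]) blast
  moreover have "openin X (\<Inter>i\<le>n. V i)" using V(1) by (intro openin_INT2) auto
  ultimately show "\<exists>V. openin X V \<and> x \<in> V \<and> countable {A \<in> (\<Union>i\<le>n. Fs i). A \<inter> V \<noteq> {}}"
    using V(2) by blast
qed

text \<open>Let \<open>V\<close> contain \<open>K\<close> and meet only countably many members of
  \<open>F\<close>. If a box shares a compact set with the box of \<open>V\<close>, that set lies in
  \<open>V\<close> and meets every listed set, so the list is a finite sequence over a countable
  family.\<close>

lemma locally_countable_vietoris_boxes:
  assumes F: "locally_countable_family X F"
  shows "locally_countable_family (hyperspace_K X) (vietoris_box X ` {Us. Us \<noteq> [] \<and> set Us \<subseteq> F})"
  unfolding locally_countable_family_def
proof
  fix K assume "K \<in> topspace (hyperspace_K X)"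
  then have K: "compactin X K" "K \<noteq> {}" by (auto simp: topspace_hyperspace_K)
  obtain V where V: "openin X V" "K \<subseteq> V" "countable {A \<in> F. A \<inter> V \<noteq> {}}"
    using locally_countable_family_compact_nbhd [OF F K(1)] by blast
  let ?N = "vietoris_box X [V]"
  have "{\<A> \<in> vietoris_box X ` {Us. Us \<noteq> [] \<and> set Us \<subseteq> F}. \<A> \<inter> ?N \<noteq> {}}
      \<subseteq> vietoris_box X ` lists {A \<in> F. A \<inter> V \<noteq> {}}"
  proof
    fix \<A> assume "\<A> \<in> {\<A> \<in> vietoris_box X ` {Us. Us \<noteq> [] \<and> set Us \<subseteq> F}. \<A> \<inter> ?N \<noteq> {}}"
    then obtain Us L where Us: "\<A> = vietoris_box X Us"
      and "set Us \<subseteq> F" "L \<in> vietoris_box X Us" "L \<in> ?N" by blast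
    moreover from this have "L \<subseteq> V" "\<forall>U\<in>set Us. L \<inter> U \<noteq> {}"
      by (simp_all add: vietoris_box_def)
    ultimately have "\<forall>U\<in>set Us. U \<in> F \<and> U \<inter> V \<noteq> {}" by blast
    then show "\<A> \<in> vietoris_box X ` lists {A \<in> F. A \<inter> V \<noteq> {}}"
      unfolding Us by (intro imageI) auto
  qed
  moreover have "countable (vietoris_box X ` lists {A \<in> F. A \<inter> V \<noteq> {}})"
    using V(3) by simp
  ultimately have "countable {\<A> \<in> vietoris_box X ` {Us. Us \<noteq> [] \<and> set Us \<subseteq> F}. \<A> \<inter> ?N \<noteq> {}}"
    by (rule countable_subset)
  moreover have "openin (hyperspace_K X) ?N" using V(1) by (auto intro: openin_vietoris_box)
  moreover have "K \<in> ?N" using K V(2) by (auto simp: vietoris_box_def)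
  ultimately show "\<exists>V. openin (hyperspace_K X) V \<and> K \<in> V \<and>
      countable {\<A> \<in> vietoris_box X ` {Us. Us \<noteq> [] \<and> set Us \<subseteq> F}. \<A> \<inter> V \<noteq> {}}" by blast
qed

text \<open>A finite list from \<open>B\<close> uses only levels up to some \<open>n\<close>, so the
  boxes over the first levels exhaust all boxes.\<close>

lemma sigma_locally_countable_vietoris_boxes:
  assumes "sigma_locally_countable X B"
  shows "sigma_locally_countable (hyperspace_K X)
    (vietoris_box X ` {Us. Us \<noteq> [] \<and> set Us \<subseteq> B})"
proof -
  obtain Fs :: "nat \<Rightarrow> _" where Fs: "B = (\<Union>n. Fs n)" "\<And>n. locally_countable_family X (Fs n)"
    using assms unfolding sigma_locally_countable_def by blast
  define E where "E n = vietoris_box X ` {Us. Us \<noteq> [] \<and> set Us \<subseteq> (\<Union>i\<le>n. Fs i)}" for n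
  have "\<exists>n. set Us \<subseteq> (\<Union>i\<le>n. Fs i)" if "set Us \<subseteq> B" for Us
  proof -
    have "\<forall>U\<in>set Us. \<exists>i. U \<in> Fs i" using that Fs(1) by blast
    then obtain i where i: "\<And>U. U \<in> set Us \<Longrightarrow> U \<in> Fs (i U)" by metis
    have "i U \<le> Max (i ` set Us)" if "U \<in> set Us" for U using that by simp
    with i have "set Us \<subseteq> (\<Union>j\<le>Max (i ` set Us). Fs j)" by blast
    then show ?thesis by blast
  qed
  then have "{Us. Us \<noteq> [] \<and> set Us \<subseteq> B} = (\<Union>n. {Us. Us \<noteq> [] \<and> set Us \<subseteq> (\<Union>i\<le>n. Fs i)})"
    unfolding Fs(1) by (intro equalityI subsetI) (simp, blast)+
  then have "vietoris_box X ` {Us. Us \<noteq> [] \<and> set Us \<subseteq> B} = (\<Union>n. E n)"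
    unfolding E_def by (simp only: image_UN)
  moreover have "locally_countable_family (hyperspace_K X) (E n)" for n
    unfolding E_def
    by (intro locally_countable_vietoris_boxes locally_countable_family_UN Fs(2))
  ultimately show ?thesis unfolding sigma_locally_countable_def by blast
qed

text \<open>With \<open>K = {}\<close> this is the embedding of \<open>X\<close> by singletons.\<close>

lemma continuous_map_insert_hyperspace:
  assumes K: "compactin X K"
  shows "continuous_map X (hyperspace_K X) (\<lambda>x. insert x K)"
proof -
  have comp: "compactin X (insert x K)" if "x \<in> topspace X" for x
    using compactin_Un [OF _ K, of "{x}"] that by simp
  show ?thesis
    unfolding hyperspace_K_def
  proof (rule continuous_on_generated_topo)
    fix G assume "G \<in> vietoris_base X"
    then obtain Us where Us: "G = vietoris_box X Us" "Us \<noteq> []" "\<And>U. U \<in> set Us \<Longrightarrow> openin X U"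
      by (auto simp: vietoris_base_def)
    \<comment> \<open>The listed sets that \<open>K\<close> misses must be met by the added point
      itself. Intersecting with \<open>topspace X\<close> below covers the case that there are
      none.\<close>
    let ?D = "{U \<in> set Us. K \<inter> U = {}}"
    show "openin X ((\<lambda>x. insert x K) -` G \<inter> topspace X)"
    proof (cases "K \<subseteq> \<Union>(set Us)")
      case True
      then have "(\<lambda>x. insert x K) -` G \<inter> topspace X = (topspace X \<inter> \<Inter>?D) \<inter> \<Union>(set Us)"
        using Us comp by (auto simp: vietoris_box_def dest: openin_subset)
      moreover have "openin X (topspace X \<inter> \<Inter>?D)"
        by (intro openin_Int_Inter) (use Us(3) in auto)
      moreover have "openin X (\<Union>(set Us))" using Us(3) by blast
      ultimately show ?thesis by (simp add: openin_Int)
    next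
      case False
      then have "(\<lambda>x. insert x K) -` G \<inter> topspace X = {}"
        by (auto simp: Us(1) vietoris_box_def)
      then show ?thesis by simp
    qed
  next
    have "insert x K \<in> topspace (hyperspace_K X)" if "x \<in> topspace X" for x
      using comp [OF that] by (simp add: topspace_hyperspace_K)
    then show "(\<lambda>x. insert x K) ` topspace X \<subseteq> \<Union>(vietoris_base X)"
      by (auto simp: hyperspace_K_def)
  qed
qed

text \<open>A point of \<open>K\<close> outside the compact \<open>L\<close> is separated from
  \<open>L\<close> by disjoint open \<open>U\<close> and \<open>V\<close>; no set both meets
  \<open>U\<close> and lies in \<open>V\<close>. Hausdorffness makes members of the hyperspace weak
  base sequential neighbourhoods.\<close>

lemma Hausdorff_hyperspace_K:
  assumes X: "Hausdorff_space X"
  shows "Hausdorff_space (hyperspace_K X)"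
proof -
  have sep: "\<exists>U V. openin (hyperspace_K X) U \<and> openin (hyperspace_K X) V \<and> K \<in> U \<and> L \<in> V \<and> disjnt U V"
    if K: "K \<in> topspace (hyperspace_K X)" and L: "L \<in> topspace (hyperspace_K X)"
      and x: "x \<in> K" "x \<notin> L" for K L x
  proof -
    have K': "compactin X K" "K \<noteq> {}" and L': "compactin X L" "L \<noteq> {}"
      using K L by (auto simp: topspace_hyperspace_K)
    have xt: "x \<in> topspace X" using compactin_subset_topspace [OF K'(1)] x by blast
    obtain U V where U: "openin X U" "openin X V" "{x} \<subseteq> U" "L \<subseteq> V" "disjnt U V"
      using Hausdorff_space_compact_separation [OF X _ L'(1), of "{x}"] xt x by auto
    have "openin (hyperspace_K X) (vietoris_box X [U, topspace X])"
      "openin (hyperspace_K X) (vietoris_box X [V])"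
      using U by (auto intro!: openin_vietoris_box)
    moreover have "K \<in> vietoris_box X [U, topspace X]" "L \<in> vietoris_box X [V]"
      using K' L' U x compactin_subset_topspace [OF K'(1)] by (auto simp: vietoris_box_def)
    moreover have "disjnt (vietoris_box X [U, topspace X]) (vietoris_box X [V])"
      using U(5) by (auto simp: vietoris_box_def disjnt_def)
    ultimately show ?thesis by blast
  qed
  show ?thesis
    unfolding Hausdorff_space_def
  proof (intro allI impI)
    fix K L assume *: "K \<in> topspace (hyperspace_K X) \<and> L \<in> topspace (hyperspace_K X) \<and> K \<noteq> L"
    then consider x where "x \<in> K" "x \<notin> L" | x where "x \<in> L" "x \<notin> K" by blast
    then show "\<exists>U V. openin (hyperspace_K X) U \<and> openin (hyperspace_K X) V \<and> K \<in> U \<and> L \<in> V \<and> disjnt U V"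
      using sep * by cases (blast, metis disjnt_sym)
  qed
qed

section \<open>From a weak base of the hyperspace to a base\<close>

text \<open>
  The last condition on weak bases uses that the singletons form a closed subspace: an open set of
  \<open>X\<close> is tested by adding all non-singletons to its image.
\<close>

lemma weak_base_singletons:
  assumes X: "Hausdorff_space X" and P: "is_weak_base (hyperspace_K X) P"
  shows "is_weak_base X (\<lambda>x. (\<lambda>Q. {y. {y} \<in> Q}) ` P {x})"
proof -
  have cont: "continuous_map X (hyperspace_K X) (\<lambda>x. {x})"
    using continuous_map_insert_hyperspace [of X "{}"] by simp
  have sing: "{x} \<in> topspace (hyperspace_K X) \<longleftrightarrow> x \<in> topspace X" for x
    by (simp add: topspace_hyperspace_K)
  note PD = is_weak_baseD [OF P]
  show ?thesis
    unfolding is_weak_base_def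
  proof (intro conjI ballI allI impI)
    fix x T assume x: "x \<in> topspace X" and "T \<in> (\<lambda>Q. {y. {y} \<in> Q}) ` P {x}"
    then obtain Q where Q: "Q \<in> P {x}" "T = {y. {y} \<in> Q}" by blast
    have "Q \<subseteq> topspace (hyperspace_K X)" "{x} \<in> Q"
      using PD(1,2) [OF _ Q(1)] x sing by simp_all
    then show "T \<subseteq> topspace X" "x \<in> T" using Q(2) sing by auto
  next
    fix x S T assume x: "x \<in> topspace X"
      and "S \<in> (\<lambda>Q. {y. {y} \<in> Q}) ` P {x}" "T \<in> (\<lambda>Q. {y. {y} \<in> Q}) ` P {x}"
    then obtain Q R where QR: "Q \<in> P {x}" "S = {y. {y} \<in> Q}" "R \<in> P {x}" "T = {y. {y} \<in> R}"
      by blast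
    obtain W where "W \<in> P {x}" "W \<subseteq> Q \<inter> R"
      using PD(3) [OF _ QR(1,3)] x sing by auto
    then show "\<exists>W\<in>(\<lambda>Q. {y. {y} \<in> Q}) ` P {x}. W \<subseteq> S \<inter> T"
      using QR(2,4) by (intro bexI [of _ "{y. {y} \<in> W}"]) auto
  next
    fix x U assume x: "x \<in> topspace X" and U: "openin X U \<and> x \<in> U"
    have "openin (hyperspace_K X) (vietoris_box X [U])"
      using U by (intro openin_vietoris_box) auto
    moreover have "{x} \<in> vietoris_box X [U]"
      using U x by (auto simp: vietoris_box_def)
    ultimately obtain Q where "Q \<in> P {x}" "Q \<subseteq> vietoris_box X [U]" using PD(4) x sing by meson
    then show "\<exists>Q\<in>(\<lambda>Q. {y. {y} \<in> Q}) ` P {x}. Q \<subseteq> U"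
      by (auto simp: vietoris_box_def)
  next
    fix G assume G: "G \<subseteq> topspace X \<and> (\<forall>x\<in>G. \<exists>Q\<in>(\<lambda>Q. {y. {y} \<in> Q}) ` P {x}. Q \<subseteq> G)"
    define \<G> where "\<G> = {K \<in> topspace (hyperspace_K X). \<forall>x. K = {x} \<longrightarrow> x \<in> G}"
    have "openin (hyperspace_K X) \<G>"
    proof (rule openin_weak_base [OF P])
      fix K assume K: "K \<in> \<G>"
      then have Kt: "K \<in> topspace (hyperspace_K X)" by (simp add: \<G>_def)
      then have K': "compactin X K" "K \<noteq> {}" by (auto simp: topspace_hyperspace_K)
      show "\<exists>Q\<in>P K. Q \<subseteq> \<G>"
      proof (cases "\<exists>x. K = {x}")
        case True
        then obtain x where x: "K = {x}" by blast
        then have "x \<in> G" using K by (simp add: \<G>_def)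
        then obtain Q where Q: "Q \<in> P {x}" "{y. {y} \<in> Q} \<subseteq> G" using G by blast
        then have "Q \<subseteq> \<G>" using PD(1) Kt x unfolding \<G>_def by blast
        then show ?thesis using Q x by blast
      next
        case False
        then obtain a b where ab: "a \<in> K" "b \<in> K" "a \<noteq> b" using K'(2) by blast
        have Kx: "K \<subseteq> topspace X" using compactin_subset_topspace [OF K'(1)] .
        then obtain U V where U: "openin X U" "openin X V" "a \<in> U" "b \<in> V" "disjnt U V"
          using X ab unfolding Hausdorff_space_def by (meson subsetD)
        \<comment> \<open>A set meeting both of the disjoint \<open>U\<close> and \<open>V\<close>
          is not a singleton, so this box lies in \<G>. The entry \<open>topspace X\<close> lifts
          the covering constraint.\<close>
        let ?Us = "[U, V, topspace X]"
        have "openin (hyperspace_K X) (vietoris_box X ?Us)"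
          using U by (intro openin_vietoris_box) auto
        moreover have "K \<in> vietoris_box X ?Us"
          using K' Kx U ab by (auto simp: vietoris_box_def)
        ultimately obtain Q where "Q \<in> P K" "Q \<subseteq> vietoris_box X ?Us" using PD(4) Kt by meson
        moreover have "vietoris_box X ?Us \<subseteq> \<G>"
          using U(5) unfolding \<G>_def topspace_hyperspace_K
          by (auto simp: vietoris_box_def disjnt_def)
        ultimately show ?thesis by blast
      qed
    qed (auto simp: \<G>_def)
    then have "openin X {x \<in> topspace X. {x} \<in> \<G>}"
      using openin_continuous_map_preimage [OF cont] by simp
    moreover have "{x \<in> topspace X. {x} \<in> \<G>} = G"
      using G by (auto simp: \<G>_def sing)
    ultimately show "openin X G" by simp
  qed
qed

text \<open>The set \<open>G\<close> of points having a member of \<open>B\<close> inside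
  \<open>Q\<close> contains \<open>x\<close> and lies in \<open>Q\<close>, so everything rests on
  its openness. If that fails, a diagonal sequence outside \<open>Q\<close> converges to a point
  \<open>z\<close> of \<open>G\<close>.\<close>

lemma weak_base_member_nbhd:
  assumes X: "Hausdorff_space X" and P: "is_weak_base (hyperspace_K X) P"
    and Pc: "\<And>K. K \<in> topspace (hyperspace_K X) \<Longrightarrow> countable (P K)"
    and B: "is_weak_base X B" and Bc: "\<And>x. x \<in> topspace X \<Longrightarrow> countable (B x)"
    and x: "x \<in> topspace X" and Q: "Q \<in> B x"
  shows "x \<in> X interior_of Q"
proof -
  define G where "G = {z \<in> topspace X. \<exists>V\<in>B z. V \<subseteq> Q}"
  have "openin X G"
  proof (rule ccontr)
    assume "\<not> openin X G"
    then obtain z where z: "z \<in> G" "\<And>V. V \<in> B z \<Longrightarrow> \<not> V \<subseteq> G"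
      using openin_weak_base [OF B, of G] unfolding G_def by blast
    then obtain V where V: "V \<in> B z" "V \<subseteq> Q" and zX: "z \<in> topspace X" by (auto simp: G_def)
    obtain p where p: "limitin X p z sequentially" "\<And>n::nat. p n \<in> topspace X - G"
      using weak_base_limit_outside [OF B zX Bc [OF zX] z(2)] by blast
    have pX: "p k \<in> topspace X" for k using p(2) by blast
    \<comment> \<open>Not a consequence of convergence to \<open>z\<close>: since \<open>p k\<close>
      is outside \<open>G\<close>, no member at \<open>p k\<close> lies in \<open>Q\<close>, so
      \<open>p k\<close> is itself a limit of points outside \<open>Q\<close>.\<close>
    have "\<exists>s. limitin X s (p k) sequentially \<and> (\<forall>n::nat. s n \<in> topspace X - Q)" for k
    proof -
      have "\<not> V \<subseteq> Q" if "V \<in> B (p k)" for V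
        using that p(2) [of k] by (auto simp: G_def)
      then show ?thesis
        using weak_base_limit_outside [OF B pX Bc [OF pX]] by metis
    qed
    then obtain w where w: "\<And>k. limitin X (w k) (p k) sequentially"
      "\<And>k n::nat. w k n \<in> topspace X - Q" by metis
    \<comment> \<open>The \<open>U n\<close> will cover early terms of the sequence; the
      \<open>W n\<close> will keep late diagonal points out of them.\<close>
    have "\<exists>U W. openin X U \<and> openin X W \<and> p n \<in> U \<and> z \<in> W \<and> disjnt U W" for n
      using X pX zX p(2) [of n] z(1) unfolding Hausdorff_space_def by (metis DiffD2)
    then obtain U W where UW: "\<And>n. openin X (U n)" "\<And>n. openin X (W n)" "\<And>n. p n \<in> U n"
      "\<And>n. z \<in> W n" "\<And>n. disjnt (U n) (W n)" by metis
    define K where "K = insert z (range p)"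
    have K: "compactin X K"
      unfolding K_def by (rule compactin_sequence_with_limit [OF p(1)]) (use pX in auto)
    then have Kt: "K \<in> topspace (hyperspace_K X)" by (auto simp: topspace_hyperspace_K K_def)
    obtain R :: "nat \<Rightarrow> _" where R: "\<And>k. R k \<in> P K"
      "\<And>Q. Q \<in> P K \<Longrightarrow> \<forall>\<^sub>F k in sequentially. R k \<subseteq> Q"
      using weak_base_sequence [OF P Kt Pc [OF Kt]] by blast
    \<comment> \<open>As \<open>p k\<close> already belongs to \<open>K\<close>, inserting points
      that tend to \<open>p k\<close> gives sets tending to \<open>K\<close> itself. Only finitely
      many open conditions at \<open>p k\<close> are added, so almost every \<open>m\<close> will
      do.\<close>
    have "\<exists>m. insert (w k m) K \<in> R k \<and> (\<forall>n<k. p k \<in> W n \<longrightarrow> w k m \<in> W n)" for k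
    proof -
      have "limitin (hyperspace_K X) (\<lambda>m. insert (w k m) K) (insert (p k) K) sequentially"
        using continuous_map_limit [OF continuous_map_insert_hyperspace [OF K] w(1)]
        by (simp add: o_def)
      moreover have "insert (p k) K = K" by (auto simp: K_def)
      ultimately have "\<forall>\<^sub>F m in sequentially. insert (w k m) K \<in> R k"
        using weak_base_eventually [OF Hausdorff_hyperspace_K [OF X] P Kt R(1)] by simp
      moreover have "\<forall>\<^sub>F m in sequentially. \<forall>n\<in>{..<k}. p k \<in> W n \<longrightarrow> w k m \<in> W n"
        using w(1) UW(2) by (intro eventually_ball_finite) (auto simp: limitin_def)
      ultimately have "\<forall>\<^sub>F m in sequentially. insert (w k m) K \<in> R k \<and>
          (\<forall>n\<in>{..<k}. p k \<in> W n \<longrightarrow> w k m \<in> W n)"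
        by (rule eventually_conj)
      from eventually_happens' [OF sequentially_bot this] show ?thesis by auto
    qed
    then obtain m where m: "\<And>k. insert (w k (m k)) K \<in> R k"
      "\<And>k n. n < k \<Longrightarrow> p k \<in> W n \<Longrightarrow> w k (m k) \<in> W n" by metis
    define v where "v k = w k (m k)" for k
    have "limitin X v z sequentially"
      unfolding limitin_def
    proof (intro conjI allI impI zX)
      fix O' assume O': "openin X O' \<and> z \<in> O'"
      then obtain N where N: "\<And>k. k \<ge> N \<Longrightarrow> p k \<in> O'"
        using p(1) by (auto simp: limitin_sequentially)
      \<comment> \<open>This open set contains all of \<open>K\<close>, not just its tail, so the
        hyperspace weak base at \<open>K\<close> forces almost all \<open>v k\<close> into
        it.\<close>
      let ?O = "O' \<union> (\<Union>n<N. U n)"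
      have "p k \<in> ?O" for k
        using N [of k] UW(3) [of k] by (cases "k < N") auto
      then have "K \<in> vietoris_box X [?O]"
        using K O' by (auto simp: vietoris_box_def K_def)
      moreover have "openin (hyperspace_K X) (vietoris_box X [?O])"
        using O' UW(1) by (intro openin_vietoris_box) auto
      ultimately obtain S where S: "S \<in> P K" "S \<subseteq> vietoris_box X [?O]"
        using is_weak_baseD(4) [OF P Kt] by meson
      have "\<forall>\<^sub>F k in sequentially. v k \<in> ?O"
        using R(2) [OF S(1)]
      proof (rule eventually_mono)
        fix k assume "R k \<subseteq> S"
        then have "insert (v k) K \<in> vietoris_box X [?O]" using m(1) S(2) by (auto simp: v_def)
        then show "v k \<in> ?O" by (simp add: vietoris_box_def)
      qed
      \<comment> \<open>For such \<open>k\<close> with \<open>k \<ge> N\<close>, the second clause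
        of \<open>m\<close> puts \<open>v k\<close> in every \<open>W n\<close> with
        \<open>n < N\<close>, hence outside every such \<open>U n\<close>; only \<open>O'\<close>
        remains.\<close>
      moreover have "\<forall>\<^sub>F k in sequentially. \<forall>n\<in>{..<N}. p k \<in> W n"
        using p(1) UW(2,4) by (intro eventually_ball_finite) (auto simp: limitin_def)
      ultimately show "\<forall>\<^sub>F k in sequentially. v k \<in> O'"
        using eventually_ge_at_top [of N]
      proof eventually_elim
        case (elim k)
        then have "v k \<in> W n" if "n < N" for n
          using m(2) [of n k] that by (auto simp: v_def)
        then have "v k \<notin> U n" if "n < N" for n
          using UW(5) [of n] that by (auto simp: disjnt_def)
        then show ?case using elim(1) by blast
      qed
    qed
    \<comment> \<open>\<open>V\<close> is a sequential neighbourhood of \<open>z\<close> inside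
      \<open>Q\<close>, while every \<open>v k\<close> is outside \<open>Q\<close>.\<close>
    then have "\<forall>\<^sub>F k in sequentially. v k \<in> V"
      using weak_base_eventually [OF X B zX V(1)] by simp
    then obtain k where "v k \<in> V"
      using eventually_happens' [OF sequentially_bot] by blast
    then show False using V(2) w(2) by (auto simp: v_def)
  qed
  moreover have "x \<in> G" using x Q by (auto simp: G_def)
  moreover have "G \<subseteq> Q" using is_weak_baseD(2) [OF B] by (auto simp: G_def)
  ultimately show ?thesis by (auto simp: interior_of_def)
qed

text \<open>The base consists of the interiors of the traces of weak-base members on singletons.
  Each trace is a neighbourhood of its point, and passing to interiors keeps the inclusion required
  for pulling back along singletons.\<close>

lemma base_from_hyperspace_weak_base:
  assumes X: "Hausdorff_space X" and P: "is_weak_base (hyperspace_K X) P"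
    and \<sigma>: "sigma_locally_countable (hyperspace_K X) (\<Union>K\<in>topspace (hyperspace_K X). P K)"
      (is "sigma_locally_countable _ ?F")
  shows "\<exists>B. is_base X B \<and> sigma_locally_countable X B"
proof -
  define h where "h Q = X interior_of {y. {y} \<in> Q}" for Q
  define B where "B x = (\<lambda>Q. {y. {y} \<in> Q}) ` P {x}" for x
  have B: "is_weak_base X B"
    using weak_base_singletons [OF X P] by (simp add: B_def [abs_def])
  have Pc: "countable (P K)" if "K \<in> topspace (hyperspace_K X)" for K
  proof (rule countable_subset [OF _ sigma_locally_countable_point [OF \<sigma> that]])
    show "P K \<subseteq> {A \<in> ?F. K \<in> A}" using is_weak_baseD(2) [OF P that] that by blast
  qed
  have sing: "{x} \<in> topspace (hyperspace_K X)" if "x \<in> topspace X" for x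
    using that by (simp add: topspace_hyperspace_K)
  have Bc: "countable (B x)" if "x \<in> topspace X" for x
    using Pc [OF sing [OF that]] by (simp add: B_def)
  have "is_base X (h ` ?F)"
    unfolding is_base_def
  proof (intro conjI ballI allI impI)
    fix U x assume U: "openin X U \<and> x \<in> U"
    then have x: "x \<in> topspace X" using openin_subset by blast
    then obtain T where T: "T \<in> B x" "T \<subseteq> U" using is_weak_baseD(4) [OF B] U by blast
    then obtain Q where Q: "Q \<in> P {x}" "T = {y. {y} \<in> Q}" by (auto simp: B_def)
    have "x \<in> h Q"
      using weak_base_member_nbhd [OF X P Pc B Bc x T(1)] Q(2) by (simp add: h_def)
    moreover have "h Q \<subseteq> U"
      unfolding h_def Q(2) [symmetric] using T(2) interior_of_subset by (rule order_trans [rotated])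
    ultimately show "\<exists>V\<in>h ` ?F. x \<in> V \<and> V \<subseteq> U"
      using Q(1) sing [OF x] by blast
  qed (auto simp: h_def)
  moreover have "sigma_locally_countable X (h ` ?F)"
  proof (rule sigma_locally_countable_pullback [OF _ \<sigma>])
    show "continuous_map X (hyperspace_K X) (\<lambda>x. {x})"
      using continuous_map_insert_hyperspace [of X "{}"] by simp
    show "h Q \<subseteq> (\<lambda>x. {x}) -` Q" for Q
      using interior_of_subset [of X "{y. {y} \<in> Q}"] by (auto simp: h_def)
  qed
  ultimately show ?thesis by blast
qed

theorem theorem3p12:
  fixes X :: "'a topology"
  assumes "regular_space X" and "Hausdorff_space X"
  shows "((\<exists>B. is_base X B \<and> sigma_locally_countable X B) \<longleftrightarrow>
          (\<exists>P. is_weak_base (hyperspace_K X) P \<and>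
               sigma_locally_countable (hyperspace_K X) (\<Union>K\<in>topspace (hyperspace_K X). P K)))
       \<and> ((\<exists>P. is_weak_base (hyperspace_K X) P \<and>
               sigma_locally_countable (hyperspace_K X) (\<Union>K\<in>topspace (hyperspace_K X). P K)) \<longleftrightarrow>
          (\<exists>B. is_base (hyperspace_K X) B \<and> sigma_locally_countable (hyperspace_K X) B))"
    (is "(?base \<longleftrightarrow> ?weak) \<and> (?weak \<longleftrightarrow> ?hbase)")
proof -
  \<comment> \<open>The three implications form a cycle: boxes over a base, a base viewed as a weak
    base, and the return from the hyperspace to \<open>X\<close>.\<close>
  have "?base \<Longrightarrow> ?hbase"
    using is_base_vietoris_boxes sigma_locally_countable_vietoris_boxes by blast
  moreover have "?hbase \<Longrightarrow> ?weak"
  proof -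
    assume ?hbase
    then obtain B where B: "is_base (hyperspace_K X) B" "sigma_locally_countable (hyperspace_K X) B"
      by blast
    have "sigma_locally_countable (hyperspace_K X)
        (\<Union>K\<in>topspace (hyperspace_K X). {V \<in> B. K \<in> V})"
      by (rule sigma_locally_countable_subset [OF B(2)]) blast
    with is_base_imp_weak_base [OF B(1)] show ?weak by blast
  qed
  moreover have "?weak \<Longrightarrow> ?base"
    using base_from_hyperspace_weak_base [OF assms(2)] by blast
  ultimately show ?thesis by blast
qed

end
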